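(* Let $p_1, p_2,\ldots , p_t$ be distinct primes. Then $K(p_1, p_2,\ldots , p_t)$ is nonempty if and only if $$\frac{p_1}{p_1-1}\cdots \frac{p_t}{p_t-1}>2.$$
   Context: Let $\mathbb{N}_0$ be the set of nonnegative integers. For distinct primes $p_1,\ldots,p_t$, let $S(p_1,\ldots , p_t)=\{ p_1^{\alpha_1}\cdots p_t^{\alpha_t}\mid \alpha_i\in \mathbb{N}_0,\ i=1,\ldots , t \}$. For a positive integer $k$, $T_k(p_1,\ldots , p_t)$ is the number of solutions of $\sum_{i=1}^{k}\frac 1{x_i}=1$ with $1<x_1<x_2<\cdots <x_{k}$ and $x_i\in S(p_1,\ldots , p_t)$ for $1\le i\le k$. Define $K(p_1,\ldots , p_t)=\{ k\ge 1 : T_{k} (p_1,\ldots ,p_t)\ge 1\}$. *)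

theory Defs
  imports Complex_Main "HOL-Computational_Algebra.Primes"
begin

definition S :: "nat list \<Rightarrow> nat set" where
  "S ps = {\<Prod>i<length ps. (ps ! i) ^ \<alpha> i | \<alpha> :: nat \<Rightarrow> nat. True}"

text \<open>A solution \<open>1 < x\<^sub>1 < \<dots> < x\<^sub>k\<close> is encoded as the list of its entries.\<close>

definition solutions :: "nat \<Rightarrow> nat list \<Rightarrow> nat list set" where
  "solutions k ps =
     {xs. length xs = k \<and> sorted_wrt (<) xs \<and> (\<forall>x\<in>set xs. 1 < x \<and> x \<in> S ps) \<and>
          (\<Sum>x\<leftarrow>xs. 1 / real x) = 1}"

definition T :: "nat \<Rightarrow> nat list \<Rightarrow> nat" where
  "T k ps = card (solutions k ps)"

definition K :: "nat list \<Rightarrow> nat set" where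
  "K ps = {k. k \<ge> 1 \<and> T k ps \<ge> 1}"

text \<open>There are only finitely many solutions of each length, so \<open>card\<close> counts them properly.\<close>

lemma finite_unit_fraction_lists:
  "finite {xs :: nat list. length xs = k \<and> sorted_wrt (<) xs \<and> (\<forall>x\<in>set xs. 0 < x) \<and>
     (\<Sum>x\<leftarrow>xs. 1 / real x) = r}" (is "finite (?A k r)")
proof (induction k arbitrary: r)
  case 0
  have "?A 0 r \<subseteq> {[]}" by auto
  then show ?case by (rule finite_subset) simp
next
  case (Suc k)
  let ?B = "{..nat \<lfloor>real (Suc k) / r\<rfloor>}"
  have "?A (Suc k) r \<subseteq> (\<Union>x\<in>?B. (#) x ` ?A k (r - 1 / real x))"
  proof
    fix xs assume xs: "xs \<in> ?A (Suc k) r"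
    then obtain x ys where xs_eq: "xs = x # ys" by (cases xs) auto
    have x: "0 < x" and len: "length ys = k" and ge: "\<forall>y\<in>set ys. x < y"
      and sum: "1 / real x + (\<Sum>y\<leftarrow>ys. 1 / real y) = r"
      using xs by (auto simp: xs_eq)
    have "(\<Sum>y\<leftarrow>ys. 1 / real y) \<le> (\<Sum>y\<leftarrow>ys. 1 / real x)"
      using ge x by (intro sum_list_mono) (auto simp: frac_le)
    then have le: "r \<le> real (Suc k) / real x"
      using sum len by (simp add: sum_list_triv add_divide_distrib)
    have "0 \<le> (\<Sum>y\<leftarrow>ys. 1 / real y)" by (rule sum_list_nonneg) auto
    then have "0 < r" using sum x by (smt (verit) of_nat_0_less_iff zero_less_divide_1_iff)
    then have "real x \<le> real (Suc k) / r" using le x by (simp add: field_simps)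
    then have "x \<in> ?B" by (simp add: le_nat_floor)
    moreover have "ys \<in> ?A k (r - 1 / real x)" using xs sum by (auto simp: xs_eq)
    ultimately show "xs \<in> (\<Union>x\<in>?B. (#) x ` ?A k (r - 1 / real x))" using xs_eq by blast
  qed
  moreover have "finite (\<Union>x\<in>?B. (#) x ` ?A k (r - 1 / real x))"
    using Suc.IH by (intro finite_UN_I finite_imageI) auto
  ultimately show ?case by (rule finite_subset)
qed

lemma finite_solutions: "finite (solutions k ps)"
  by (rule finite_subset[OF _ finite_unit_fraction_lists[of k 1]]) (auto simp: solutions_def)

end

theory Submission
  imports Defs "HOL-Number_Theory.Residues"
begin

text \<open>
  Let \<open>R\<close> be the product of the primes, so that the smooth numbers are the divisors of the powers
  of \<open>R\<close>. The reciprocals of all smooth numbers sum to \<open>\<Prod> p / (p - 1)\<close>; a solution together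
  with \<open>x = 1\<close> gives a finite part of this series with sum 2, hence the product exceeds 2.

  Conversely, a solution amounts to writing some \<open>N = R ^ n\<close> as a sum of distinct numbers \<open>N / x\<close>
  with \<open>x > 1\<close> smooth, that is, of proper divisors of \<open>N\<close> and of non-integral quotients of smooth
  numbers. If the product exceeds 2, then for a constant \<open>J\<close> independent of \<open>n\<close> every divisor of \<open>N\<close>
  is at most \<open>J\<close> plus the sum of the smaller divisors. So the subset sums of the proper divisors,
  thickened by \<open>{0..J}\<close>, fill an interval, and it suffices to obtain all of \<open>{M..M + J}\<close> as subset
  sums of a fixed finite set of non-integral quotients, for some natural number \<open>M\<close>.
  Such a set is a union of pairs \<open>A\<close>, \<open>B\<close> with \<open>\<Sum>B - \<Sum>A = 1\<close>: the pigeonhole principle yields two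
  equal subset sums of numbers \<open>p ^ (g * i) * q ^ (g * j)\<close>, and dividing by the largest term
  turns all the other terms into non-integers. Large \<open>g\<close> makes successive pairs disjoint.
  Finitely many further quotients make \<open>M\<close> integral.
\<close>

section \<open>Divisors of powers of the product of the primes\<close>

text \<open>A divisor of a product of coprime numbers splits uniquely into divisors of the two
  factors.\<close>

lemma sum_inverse_divisors_coprime_mult:
  fixes a b :: nat
  assumes "coprime a b" "a > 0" "b > 0"
  shows "(\<Sum>x | x dvd a * b. 1 / real x) = (\<Sum>x | x dvd a. 1 / real x) * (\<Sum>x | x dvd b. 1 / real x)"
proof -
  have inj: "inj_on (\<lambda>(x, y). x * y) ({x. x dvd a} \<times> {y. y dvd b})"
  proof (rule inj_onI, clarsimp)
    fix x y x' y' assume h: "x dvd a" "y dvd b" "x' dvd a" "y' dvd b" "x * y = x' * y'"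
    have "coprime x y'" "coprime x' y"
      using h assms(1) by (meson coprime_divisors)+
    then have "x dvd x'" "x' dvd x"
      using h(5) by (metis coprime_dvd_mult_left_iff dvd_triv_left)+
    then have "x = x'" by (rule dvd_antisym)
    moreover have "x > 0" using h assms by (auto intro: dvd_pos_nat)
    ultimately show "x = x' \<and> y = y'" using h(5) by simp
  qed
  have img: "(\<lambda>(x, y). x * y) ` ({x. x dvd a} \<times> {y. y dvd b}) = {x. x dvd a * b}"
    by (auto simp: image_iff intro: mult_dvd_mono) (meson division_decomp)
  have "(\<Sum>x | x dvd a * b. 1 / real x)
      = (\<Sum>z \<in> {x. x dvd a} \<times> {y. y dvd b}. 1 / real (case z of (x, y) \<Rightarrow> x * y))"
    by (subst img [symmetric], subst sum.reindex [OF inj]) simp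
  also have "\<dots> = (\<Sum>x | x dvd a. \<Sum>y | y dvd b. 1 / real x * (1 / real y))"
    by (subst sum.cartesian_product) (auto intro!: sum.cong)
  also have "\<dots> = (\<Sum>x | x dvd a. 1 / real x) * (\<Sum>x | x dvd b. 1 / real x)"
    by (simp add: sum_product)
  finally show ?thesis .
qed

lemma sum_inverse_divisors_prime_power:
  assumes "prime (p :: nat)"
  shows "(\<Sum>x | x dvd p ^ n. 1 / real x) = (\<Sum>k\<le>n. (1 / real p) ^ k)"
proof -
  have "{x. x dvd p ^ n} = (\<lambda>k. p ^ k) ` {..n}"
    using assms by (auto simp: divides_primepow_nat)
  moreover have "inj_on (\<lambda>k. p ^ k) {..n}"
    using prime_gt_1_nat[OF assms] by (auto intro!: inj_onI)
  ultimately show ?thesis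
    by (simp add: sum.reindex power_one_over)
qed

locale finite_prime_set =
  fixes P :: "nat set"
  assumes finite_P: "finite P" and prime_P: "p \<in> P \<Longrightarrow> prime p"
begin

definition R :: nat where "R = \<Prod>P"

text \<open>Divisors of powers of \<open>R\<close> replace exponent vectors because finitely many of
  them always divide a common \<open>R ^ n\<close>; \<open>S_eq_smooth\<close> gives the link with
  \<open>S\<close>.\<close>

definition smooth :: "nat set" where "smooth = {x. \<exists>n. x dvd R ^ n}"

lemma R_pos: "R > 0"
  unfolding R_def using prime_P by (auto intro!: prod_pos dest: prime_gt_0_nat)

lemma multiplicity_R: "p \<in> P \<Longrightarrow> multiplicity p (R ^ n) = n"
  using multiplicity_prod_prime_powers[OF finite_P, of p "\<lambda>_. n"] prime_P
  by (simp add: R_def prod_power_distrib)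

lemma multiplicity_R_notin: "prime p \<Longrightarrow> p \<notin> P \<Longrightarrow> multiplicity p (R ^ n) = 0"
  using multiplicity_prod_prime_powers[OF finite_P, of p "\<lambda>_. n"] prime_P
  by (simp add: R_def prod_power_distrib)

lemma smooth_pos: "x \<in> smooth \<Longrightarrow> x > 0"
  using R_pos by (auto simp: smooth_def intro: dvd_pos_nat[of "R ^ _"])

lemma smooth_mult: "x \<in> smooth \<Longrightarrow> y \<in> smooth \<Longrightarrow> x * y \<in> smooth"
  unfolding smooth_def by (auto intro: mult_dvd_mono simp flip: power_add) (metis mult_dvd_mono power_add)

lemma smooth_dvd: "y dvd x \<Longrightarrow> x \<in> smooth \<Longrightarrow> y \<in> smooth"
  unfolding smooth_def using dvd_trans by blast

lemma smooth_one: "1 \<in> smooth"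
  by (simp add: smooth_def)

lemma smooth_power: "p \<in> P \<Longrightarrow> p ^ n \<in> smooth"
  using dvd_power_same[OF dvd_prodI[OF finite_P, of p "\<lambda>x. x"], of n] by (auto simp: smooth_def R_def)

lemma R_power_dvd_mono: "m \<le> n \<Longrightarrow> x dvd R ^ m \<Longrightarrow> x dvd R ^ n"
  by (meson dvd_trans le_imp_power_dvd)

lemma finite_divisors_R: "finite {x. x dvd R ^ n}"
  using R_pos by simp

lemma finite_smooth_dvd:
  assumes "finite X" "X \<subseteq> smooth"
  shows "\<exists>m. \<forall>n\<ge>m. \<forall>x\<in>X. x dvd R ^ n"
  using assms
proof (induction X)
  case (insert x X)
  then obtain m k where "\<forall>n\<ge>m. \<forall>x\<in>X. x dvd R ^ n" "x dvd R ^ k"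
    by (auto simp: smooth_def)
  then show ?case
    by (intro exI[of _ "max m k"]) (auto intro: R_power_dvd_mono)
qed simp

text \<open>A smooth number has no prime factor outside \<open>P\<close>, so only exponents at
  primes of \<open>P\<close> have to be compared.\<close>

lemma dvd_R_powerI:
  assumes "x \<in> smooth" "\<And>p. p \<in> P \<Longrightarrow> multiplicity p x \<le> n"
  shows "x dvd R ^ n"
proof (rule multiplicity_le_imp_dvd)
  show "x \<noteq> 0" using smooth_pos[OF assms(1)] by simp
  fix p :: nat assume p: "prime p"
  show "multiplicity p x \<le> multiplicity p (R ^ n)"
  proof (cases "p \<in> P")
    case True then show ?thesis using assms(2) by (simp add: multiplicity_R)
  next
    case False
    obtain m where "x dvd R ^ m" using assms(1) by (auto simp: smooth_def)
    then have "multiplicity p x \<le> multiplicity p (R ^ m)"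
      using R_pos by (intro dvd_imp_multiplicity_le) auto
    then show ?thesis using False p by (simp add: multiplicity_R_notin)
  qed
qed

text \<open>The Euler product truncated at exponent \<open>n\<close>, by induction over the
  primes.\<close>

lemma sum_inverse_divisors_R:
  "(\<Sum>x | x dvd R ^ n. 1 / real x) = (\<Prod>p\<in>P. \<Sum>k\<le>n. (1 / real p) ^ k)"
proof -
  have "Q \<subseteq> P \<Longrightarrow> (\<Sum>x | x dvd (\<Prod>Q) ^ n. 1 / real x) = (\<Prod>p\<in>Q. \<Sum>k\<le>n. (1 / real p) ^ k)" if "finite Q" for Q
    using that
  proof (induction Q)
    case (insert p Q)
    have pr: "prime p" "\<And>q. q \<in> Q \<Longrightarrow> prime q" using insert prime_P by auto
    have "coprime p (\<Prod>Q)"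
      using pr insert by (intro prod_coprime_right) (auto intro: primes_coprime)
    then have "coprime (p ^ n) (\<Prod>Q ^ n)" by simp
    moreover have "\<Prod>Q > 0" using pr by (auto intro!: prod_pos dest: prime_gt_0_nat)
    ultimately show ?case
      using insert pr prime_gt_0_nat[OF pr(1)]
      by (simp add: power_mult_distrib sum_inverse_divisors_coprime_mult sum_inverse_divisors_prime_power)
  qed simp
  from this[OF finite_P] show ?thesis by (simp add: R_def)
qed

text \<open>Each truncated geometric series lies strictly below its limit; the product inherits
  strictness because it has at least one factor.\<close>

lemma sum_inverse_divisors_R_less:
  assumes "P \<noteq> {}"
  shows "(\<Sum>x | x dvd R ^ n. 1 / real x) < (\<Prod>p\<in>P. real p / (real p - 1))"
  unfolding sum_inverse_divisors_R
proof -
  have lt: "(\<Sum>k\<le>n. (1 / real p) ^ k) < real p / (real p - 1)" if "p \<in> P" for p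
  proof -
    have p1: "real p > 1" using that prime_P prime_gt_1_nat by auto
    have "(\<Sum>k\<le>n. (1 / real p) ^ k) = (1 - (1 / real p) ^ Suc n) / (1 - 1 / real p)"
      using p1 by (simp only: sum_gp0) simp
    also have "\<dots> < 1 / (1 - 1 / real p)"
      using p1 by (intro divide_strict_right_mono) auto
    also have "\<dots> = real p / (real p - 1)" using p1 by (simp add: field_simps)
    finally show ?thesis .
  qed
  have pos: "0 \<le> (\<Sum>k\<le>n. (1 / real p) ^ k)" for p by (intro sum_nonneg) auto
  obtain p where "p \<in> P" using assms by auto
  then show "(\<Prod>p\<in>P. \<Sum>k\<le>n. (1 / real p) ^ k) < (\<Prod>p\<in>P. real p / (real p - 1))"
    using lt pos finite_P
    by (intro prod_mono_strict[of p]) (auto intro: less_imp_le le_less_trans[OF pos])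
qed

lemma sum_inverse_divisors_R_tendsto:
  "(\<lambda>n. \<Sum>x | x dvd R ^ n. 1 / real x) \<longlonglongrightarrow> (\<Prod>p\<in>P. real p / (real p - 1))"
  unfolding sum_inverse_divisors_R
proof (rule tendsto_prod)
  fix p assume "p \<in> P"
  then have p1: "real p > 1" using prime_P prime_gt_1_nat by auto
  have "(\<lambda>k. (1 / real p) ^ k) sums (1 / (1 - 1 / real p))"
    using p1 by (intro geometric_sums) auto
  moreover have "1 / (1 - 1 / real p) = real p / (real p - 1)" using p1 by (simp add: field_simps)
  ultimately show "(\<lambda>n. \<Sum>k\<le>n. (1 / real p) ^ k) \<longlonglongrightarrow> real p / (real p - 1)"
    by (simp add: sums_def_le)
qed


section \<open>Divisors compared with the sum of the smaller divisors\<close>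

text \<open>The numbers \<open>d div x\<close> with \<open>x > 1\<close> dividing
  \<open>R ^ A\<close> are distinct smaller divisors, and they sum to \<open>d\<close> times a
  factor of at least \<open>2 - 1\<close>.\<close>

lemma le_sum_smaller_divisors_if_multiple:
  assumes A: "(\<Sum>x | x dvd R ^ A. 1 / real x) \<ge> 2" and "R ^ A dvd d" and d: "d dvd R ^ n"
  shows "d \<le> (\<Sum>d' | d' dvd R ^ n \<and> d' < d. d')"
proof -
  have dpos: "d > 0" using d R_pos by (auto intro: dvd_pos_nat[of "R ^ n"])
  define X where "X = {x. x dvd R ^ A} - {1}"
  have fX: "finite X" using finite_divisors_R by (simp add: X_def)
  have Xd: "x dvd d" if "x \<in> X" for x using that assms(2) dvd_trans by (auto simp: X_def)
  have X2: "x > 1" if "x \<in> X" for x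
  proof -
    have "x > 0" "x \<noteq> 1" using that Xd[OF that] dpos by (auto simp: X_def)
    then show ?thesis by simp
  qed
  have "1 \<le> (\<Sum>x\<in>X. 1 / real x)"
    using A finite_divisors_R[of A] by (simp add: X_def sum_diff1)
  then have "real d * 1 \<le> real d * (\<Sum>x\<in>X. 1 / real x)"
    by (intro mult_left_mono) auto
  also have "\<dots> = real (\<Sum>x\<in>X. d div x)"
    using Xd by (simp add: sum_distrib_left real_of_nat_div)
  finally have "d \<le> (\<Sum>x\<in>X. d div x)" by (simp only: mult_1_right of_nat_le_iff)
  also have "\<dots> = \<Sum>((\<lambda>x. d div x) ` X)"
  proof (subst sum.reindex)
    show "inj_on (\<lambda>x. d div x) X"
    proof (rule inj_onI)
      fix x y assume xy: "x \<in> X" "y \<in> X" "d div x = d div y"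
      have "x * (d div x) = d" "y * (d div x) = d"
        using Xd[OF xy(1)] Xd[OF xy(2)] xy(3) by (metis dvd_mult_div_cancel)+
      then have "x * (d div x) = y * (d div x)" "d div x \<noteq> 0" using dpos by (metis mult_0_right less_irrefl)+
      then show "x = y" by simp
    qed
  qed simp
  also have "\<dots> \<le> (\<Sum>d' | d' dvd R ^ n \<and> d' < d. d')"
  proof (rule sum_mono2)
    show "finite {d'. d' dvd R ^ n \<and> d' < d}" by simp
    show "(\<lambda>x. d div x) ` X \<subseteq> {d'. d' dvd R ^ n \<and> d' < d}"
    proof clarify
      fix x assume x: "x \<in> X"
      then obtain k where "d = x * k" using Xd by (auto elim: dvdE)
      then show "d div x dvd R ^ n \<and> d div x < d"
        using X2[OF x] dpos d by (auto dest: dvd_mult_right)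
    qed
  qed simp
  finally show ?thesis .
qed

text \<open>Trading \<open>p ^ k\<close> for the largest smaller power of \<open>q\<close> loses less than a factor \<open>q\<close>;
  doing so for \<open>k = 1, \<dots>, q\<close> gives \<open>q\<close> smaller divisors with sum at least \<open>d\<close>.\<close>

lemma le_sum_smaller_divisors_if_exchange:
  assumes p: "p \<in> P" "A < multiplicity p d" and q: "q \<in> P" "multiplicity q d < A"
    and "q \<le> A" and n: "A + R ^ A \<le> n" and d: "d dvd R ^ n"
  shows "d \<le> (\<Sum>d' | d' dvd R ^ n \<and> d' < d. d')"
proof -
  have dpos: "d > 0" using d R_pos by (auto intro: dvd_pos_nat[of "R ^ n"])
  have pq: "prime p" "prime q" "p \<noteq> q" using p q prime_P by auto
  have p2: "p \<ge> 2" and q2: "q \<ge> 2" using pq prime_ge_2_nat by auto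
  have "\<exists>j. q ^ j < p ^ k \<and> p ^ k \<le> q ^ (j + 1)" if "k \<ge> 1" for k
    using that p2 self_le_power[of p k] by (intro ex_power_ivl2[OF q2]) linarith
  then obtain \<beta> where \<beta>: "q ^ \<beta> k < p ^ k" "p ^ k \<le> q ^ (\<beta> k + 1)" if "k \<ge> 1" for k
    by metis
  define f where "f k = d div p ^ k * q ^ \<beta> k" for k
  have pk: "p ^ k dvd d" if "k \<in> {1..q}" for k
    using that p \<open>q \<le> A\<close> by (intro multiplicity_dvd') auto
  have fk: "f k * p ^ k = d * q ^ \<beta> k" if "k \<in> {1..q}" for k
    using pk[OF that] by (auto simp: f_def elim!: dvdE)
  have ppos: "p ^ k > 0" for k using p2 by simp
  have fpos: "f k > 0" if "k \<in> {1..q}" for k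
  proof -
    have "f k * p ^ k > 0" using fk[OF that] dpos q2 by simp
    then show ?thesis by simp
  qed
  have lt: "f k < d" if k: "k \<in> {1..q}" for k
  proof -
    have "f k * p ^ k < d * p ^ k" using fk[OF k] \<beta>(1)[of k] k dpos by simp
    then show ?thesis by simp
  qed
  have ge: "d \<le> f k * q" if k: "k \<in> {1..q}" for k
  proof -
    have "d * p ^ k \<le> d * q ^ (\<beta> k + 1)" using \<beta>(2)[of k] k by simp
    also have "\<dots> = f k * q * p ^ k" using fk[OF k] by (simp add: mult_ac)
    finally show ?thesis using p2 by simp
  qed
  have mult_f: "multiplicity r (f k) + multiplicity r (p ^ k) = multiplicity r d + multiplicity r (q ^ \<beta> k)"
    if k: "k \<in> {1..q}" and r: "prime r" for k r
  proof -
    have "multiplicity r (f k * p ^ k) = multiplicity r (d * q ^ \<beta> k)" using fk[OF k] by simp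
    then show ?thesis
      using r fpos[OF k] dpos p2 q2 by (simp add: prime_elem_multiplicity_mult_distrib)
  qed
  \<comment> \<open>The exponent of \<open>p\<close> in \<open>f k\<close> is that in
    \<open>d\<close> lowered by \<open>k\<close>, so it determines \<open>k\<close>.\<close>
  have inj: "inj_on f {1..q}"
  proof (rule inj_onI)
    fix k l assume kl: "k \<in> {1..q}" "l \<in> {1..q}" "f k = f l"
    have "multiplicity p (q ^ j) = 0" for j
      using pq by (simp add: multiplicity_distinct_prime_power)
    then show "k = l"
      using mult_f[OF kl(1) pq(1)] mult_f[OF kl(2) pq(1)] kl(3) pq by simp
  qed
  have dv: "f k dvd R ^ n" if k: "k \<in> {1..q}" for k
  proof (rule dvd_R_powerI)
    have "d \<in> smooth" using d by (auto simp: smooth_def)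
    then show "f k \<in> smooth"
      unfolding f_def using dvd_div_mult_self[OF pk[OF k]] q
      by (intro smooth_mult smooth_power) (metis smooth_dvd dvd_triv_left)+
    fix r assume r: "r \<in> P"
    then have rp: "prime r" by (rule prime_P)
    have md: "multiplicity r d \<le> n"
      using dvd_imp_multiplicity_le[OF d, of r] R_pos r by (simp add: multiplicity_R)
    show "multiplicity r (f k) \<le> n"
    proof (cases "r = q")
      case True
      \<comment> \<open>Only the exponent of \<open>q\<close> grows. It starts below
        \<open>A\<close> and gains \<open>\<beta> k < R ^ A\<close>, which is why \<open>n\<close>
        is at least \<open>A + R ^ A\<close>.\<close>
      have "\<beta> k < q ^ \<beta> k" using q2 by (intro less_exp[THEN less_le_trans] power_mono) auto
      also have "\<dots> < p ^ k" using \<beta>(1) k by simp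
      also have "\<dots> \<le> p ^ A" using p2 k \<open>q \<le> A\<close> by (intro power_increasing) auto
      also have "p dvd R"
        using dvd_prodI[OF finite_P p(1), of "\<lambda>x. x"] by (simp add: R_def)
      then have "p ^ A \<le> R ^ A" using R_pos by (auto intro: power_mono[OF dvd_imp_le])
      finally have "\<beta> k < R ^ A" .
      then show ?thesis using mult_f[OF k rp] True q pq n by simp
    next
      case False
      then have "multiplicity r (q ^ \<beta> k) = 0"
        using pq rp by (simp add: multiplicity_distinct_prime_power)
      then show ?thesis using mult_f[OF k rp] md by simp
    qed
  qed
  have "q * d = (\<Sum>k\<in>{1..q}. d)" by simp
  also have "\<dots> \<le> (\<Sum>k\<in>{1..q}. f k * q)" using ge by (intro sum_mono) auto
  also have "\<dots> = q * (\<Sum>k\<in>{1..q}. f k)" by (simp add: sum_distrib_left mult.commute)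
  finally have "d \<le> (\<Sum>k\<in>{1..q}. f k)" using q2 by simp
  also have "\<dots> = \<Sum>(f ` {1..q})" using inj by (simp add: sum.reindex)
  also have "\<dots> \<le> (\<Sum>d' | d' dvd R ^ n \<and> d' < d. d')"
    using lt dv by (intro sum_mono2) auto
  finally show ?thesis .
qed

text \<open>If \<open>d\<close> divides \<open>R ^ A\<close>, the constant alone suffices. If
  \<open>d\<close> is neither a divisor nor a multiple of \<open>R ^ A\<close>, one prime has
  exponent above \<open>A\<close> and another below \<open>A\<close>, so the exchange
  applies.\<close>

lemma divisor_le_sum_smaller_divisors:
  assumes "(\<Sum>x | x dvd R ^ A. 1 / real x) \<ge> 2" "\<And>p. p \<in> P \<Longrightarrow> p \<le> A"
    and "A + R ^ A \<le> n" and d: "d dvd R ^ n"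
  shows "d \<le> R ^ A + (\<Sum>d' | d' dvd R ^ n \<and> d' < d. d')"
proof -
  have dpos: "d > 0" using d R_pos by (auto intro: dvd_pos_nat[of "R ^ n"])
  consider "R ^ A dvd d" | "d dvd R ^ A" | "\<not> R ^ A dvd d" "\<not> d dvd R ^ A" by blast
  then show ?thesis
  proof cases
    case 1
    then show ?thesis using le_sum_smaller_divisors_if_multiple assms by (meson trans_le_add2)
  next
    case 2
    then have "d \<le> R ^ A" using R_pos by (intro dvd_imp_le) auto
    then show ?thesis by simp
  next
    case 3
    have "d \<in> smooth" using d by (auto simp: smooth_def)
    then obtain p where p: "p \<in> P" "A < multiplicity p d"
      using 3(2) dvd_R_powerI by (meson not_le)
    have "\<exists>q. prime q \<and> multiplicity q d < multiplicity q (R ^ A)"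
    proof (rule ccontr)
      assume "\<not> ?thesis"
      then have "R ^ A dvd d" using R_pos by (intro multiplicity_le_imp_dvd) (auto simp: not_less)
      then show False using 3(1) by simp
    qed
    then obtain q where "q \<in> P" "multiplicity q d < A"
      by (metis multiplicity_R multiplicity_R_notin not_less_zero)
    then show ?thesis
      using le_sum_smaller_divisors_if_exchange[OF p _ _ assms(2,3) d] by (meson trans_le_add2)
  qed
qed

end

section \<open>Intervals filled by subset sums\<close>

text \<open>Adjoining the largest element \<open>b\<close> adds a copy of the interval
  \<open>{0..J + \<Sum>B}\<close> shifted by \<open>b\<close>. The bound on \<open>b\<close> makes
  the two intervals overlap or adjoin, hence the \<open>Suc\<close>.\<close>

lemma subset_sums_extend:
  fixes B :: "nat set"
  assumes "finite B" and "\<And>d. d \<in> B \<Longrightarrow> d \<le> Suc (J + (\<Sum>d' | d' \<in> B \<and> d' < d. d'))"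
    and "r \<le> J + \<Sum>B"
  shows "\<exists>X\<subseteq>B. \<exists>j\<le>J. r = j + \<Sum>X"
  using assms
proof (induction B arbitrary: r rule: finite_linorder_max_induct)
  case (insert b B)
  have "{d'. d' \<in> insert b B \<and> d' < b} = B" using insert by auto
  then have b: "b \<le> Suc (J + \<Sum>B)" using insert.prems(1)[of b] by simp
  have "{d'. d' \<in> insert b B \<and> d' < d} = {d'. d' \<in> B \<and> d' < d}" if "d \<in> B" for d
    using insert that by auto
  then have IH: "\<exists>X\<subseteq>B. \<exists>j\<le>J. r = j + \<Sum>X" if "r \<le> J + \<Sum>B" for r
    using that insert by (metis insertCI)
  show ?case
  proof (cases "r \<le> J + \<Sum>B")
    case True then show ?thesis using IH by blast
  next
    case False
    \<comment> \<open>The truncated subtraction is exact, since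
      \<open>b \<le> Suc (J + \<Sum>B) \<le> r\<close>.\<close>
    have "r - b \<le> J + \<Sum>B" using insert by auto
    then obtain X j where X: "X \<subseteq> B" "j \<le> J" "r - b = j + \<Sum>X" using IH by blast
    have "finite X" "b \<notin> X" using X insert by (auto intro: finite_subset)
    then have "r = j + \<Sum>(insert b X)" using X b False by simp
    then show ?thesis using X by (intro exI[of _ "insert b X"] conjI exI[of _ j]) auto
  qed
qed auto

section \<open>Subset sums of non-integral quotients\<close>

lemma exists_equal_subset_sums:
  fixes W :: "nat set"
  assumes "finite W" "\<Sum>W + 1 < 2 ^ card W"
  shows "\<exists>A\<subseteq>W. \<exists>B\<subseteq>W. A \<noteq> B \<and> \<Sum>A = \<Sum>B"
proof -
  have "sum (\<lambda>x. x) ` Pow W \<subseteq> {..\<Sum>W}"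
    using assms(1) by (auto intro: sum_mono2)
  then have "card (sum (\<lambda>x. x) ` Pow W) \<le> card {..\<Sum>W}"
    by (intro card_mono) auto
  also have "\<dots> < card (Pow W)" using assms by (simp add: card_Pow)
  finally have "\<not> inj_on (sum (\<lambda>x. x)) (Pow W)" by (rule pigeonhole)
  then show ?thesis by (auto simp: inj_on_def)
qed

text \<open>Removing the common part of two subsets with equal sums makes them disjoint; they are
  swapped if necessary to put the overall maximum into \<open>A\<close>.\<close>

lemma exists_disjoint_equal_sums:
  fixes W :: "nat set"
  assumes "finite W" "\<Sum>W + 1 < 2 ^ card W"
  shows "\<exists>A B m. A \<subseteq> W \<and> B \<subseteq> W \<and> A \<inter> B = {} \<and> \<Sum>A = \<Sum>B \<and> m \<in> A \<and> (\<forall>x\<in>A \<union> B. x \<le> m)"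
proof -
  obtain A' B' where AB': "A' \<subseteq> W" "B' \<subseteq> W" "A' \<noteq> B'" "\<Sum>A' = \<Sum>B'"
    using exists_equal_subset_sums[OF assms] by blast
  define A where "A = A' - B'"
  define B where "B = B' - A'"
  have fin: "finite A'" "finite B'" using AB' assms(1) by (auto intro: finite_subset)
  have "\<Sum>A' = \<Sum>A + \<Sum>(A' \<inter> B')" "\<Sum>B' = \<Sum>B + \<Sum>(A' \<inter> B')"
    using fin sum.Int_Diff[of A' "\<lambda>x. x" B'] sum.Int_Diff[of B' "\<lambda>x. x" A']
    by (simp_all add: A_def B_def Int_commute)
  then have eq: "\<Sum>A = \<Sum>B" using AB' by simp
  define m where "m = Max (A \<union> B)"
  have ne: "A \<union> B \<noteq> {}" "finite (A \<union> B)" using AB' fin by (auto simp: A_def B_def)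
  then have m: "m \<in> A \<union> B" "\<forall>x\<in>A \<union> B. x \<le> m"
    unfolding m_def by (meson Max_in) (use ne in simp)
  have sub: "A \<subseteq> W" "B \<subseteq> W" "A \<inter> B = {}" "B \<inter> A = {}" using AB' by (auto simp: A_def B_def)
  show ?thesis
  proof (cases "m \<in> A")
    case True then show ?thesis using sub eq m by blast
  next
    case False then show ?thesis using sub eq[symmetric] m by (metis Un_iff)
  qed
qed

section \<open>Pairs of sets of quotients whose sums differ by 1\<close>

text \<open>The exponents of \<open>p\<close> and \<open>q\<close> in such a quotient are multiples
  of \<open>g\<close>. A fixed \<open>y\<close> prescribes them, so once \<open>g\<close> is large
  they can only be 0.\<close>

lemma prime_power_quotient_avoids:
  fixes p q :: nat and y :: real
  assumes pq: "prime p" "prime q" "p \<noteq> q"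
  shows "\<forall>\<^sub>F g in sequentially. \<forall>i j k l.
    real (p ^ (g * i) * q ^ (g * j)) / real (p ^ (g * k) * q ^ (g * l)) = y \<longrightarrow> i = k \<and> j = l"
proof (cases "\<exists>a b :: nat. a > 0 \<and> b > 0 \<and> y = real a / real b")
  case False
  then show ?thesis
    using prime_gt_0_nat[OF pq(1)] prime_gt_0_nat[OF pq(2)]
    by (intro always_eventually) (metis mult_pos_pos zero_less_power)
next
  case True
  then obtain a b :: nat where ab: "a > 0" "b > 0" "y = real a / real b" by blast
  define e where "e = multiplicity p a + multiplicity p b + multiplicity q a + multiplicity q b"
  show ?thesis
  proof (rule eventually_mono[OF eventually_gt_at_top[of e]], intro allI impI)
    fix g i j k l assume g: "e < g"
      and eq: "real (p ^ (g * i) * q ^ (g * j)) / real (p ^ (g * k) * q ^ (g * l)) = y"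
    have pos: "p > 0" "q > 0" using pq prime_gt_0_nat by auto
    have "real (p ^ (g * i) * q ^ (g * j) * b) = real (a * (p ^ (g * k) * q ^ (g * l)))"
      using eq ab pos by (simp add: field_simps)
    then have E: "p ^ (g * i) * q ^ (g * j) * b = a * (p ^ (g * k) * q ^ (g * l))"
      by (simp only: of_nat_eq_iff)
    have m0: "multiplicity p (q ^ r) = 0" "multiplicity q (p ^ r) = 0" for r
      using pq by (auto simp: multiplicity_distinct_prime_power)
    have 1: "g * i + multiplicity p b = multiplicity p a + g * k"
      using arg_cong[OF E, of "multiplicity p"] pos ab pq m0
      by (simp add: prime_elem_multiplicity_mult_distrib)
    have 2: "g * j + multiplicity q b = multiplicity q a + g * l"
      using arg_cong[OF E, of "multiplicity q"] pos ab pq m0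
      by (simp add: prime_elem_multiplicity_mult_distrib)
    have aux: "x = x'" if "g * x + u = v + g * x'" "u < g" "v < g" for x x' u v :: nat
    proof (rule ccontr)
      assume "x \<noteq> x'"
      then consider "Suc x \<le> x'" | "Suc x' \<le> x" by linarith
      then show False
      proof cases
        case 1 with mult_le_mono2[OF 1, of g] that show False by simp
      next
        case 2 with mult_le_mono2[OF 2, of g] that show False by simp
      qed
    qed
    show "i = k \<and> j = l"
      using aux[OF 1] aux[OF 2] g by (simp add: e_def)
  qed
qed

context finite_prime_set
begin

definition ratios :: "real set" where
  "ratios = {real a / real b | a b. a \<in> smooth \<and> b \<in> smooth}"

text \<open>Among disjoint sets \<open>C\<close>, \<open>D\<close> with equal sums, division by the
  maximum \<open>m\<close> of both turns \<open>m\<close> into 1 and every other element into a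
  number strictly between 0 and 1. \<open>Y\<close> collects values already used elsewhere.\<close>

lemma exists_unit_difference:
  assumes p: "p \<in> P" and q: "q \<in> P" "p \<noteq> q" and Y: "finite Y"
  shows "\<exists>A B. finite A \<and> finite B \<and> A \<inter> B = {} \<and> A \<union> B \<subseteq> ratios - \<nat> - Y \<and> \<Sum>B = 1 + \<Sum>A"
proof -
  have pq: "prime p" "prime q" using p q prime_P by auto
  have pos: "p > 0" "q > 0" using pq prime_gt_0_nat by auto
  define w where "w g = (\<lambda>(i, j). p ^ (g * i) * q ^ (g * j))" for g
  define Q where "Q g y \<longleftrightarrow> (\<forall>i j k l.
    real (p ^ (g * i) * q ^ (g * j)) / real (p ^ (g * k) * q ^ (g * l)) = y \<longrightarrow> i = k \<and> j = l)"
    for g and y :: real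
  have "\<forall>\<^sub>F g in sequentially. Q g y" for y
    unfolding Q_def by (rule prime_power_quotient_avoids[OF pq q(2)])
  \<comment> \<open>Avoiding the value 1 makes \<open>w g\<close> injective; avoiding
    \<open>Y\<close> keeps the new quotients fresh.\<close>
  then have "\<forall>\<^sub>F g in sequentially. \<forall>y\<in>insert 1 Y. Q g y"
    using Y by (intro eventually_ball_finite) auto
  then obtain g where "\<forall>y\<in>insert 1 Y. Q g y"
    using eventually_happens'[OF sequentially_bot] by blast
  then have g: "s = t" if "y \<in> insert 1 Y" "real (w g s) / real (w g t) = y" for y s t
  proof -
    obtain i j k l where st: "s = (i, j)" "t = (k, l)" by (metis surj_pair)
    have "Q g y" using \<open>\<forall>y\<in>insert 1 Y. Q g y\<close> that(1) by blast
    then show ?thesis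
      using that(2) unfolding st w_def Q_def prod.case by (metis (no_types))
  qed
  have wpos: "w g s > 0" for s using pos by (auto simp: w_def split: prod.splits)
  have inj: "inj (w g)"
    using g[of 1] wpos by (intro injI) auto
  define c where "c = p ^ g * q ^ g"
  \<comment> \<open>\<open>W\<close> has \<open>n * n\<close> elements, each at most
    \<open>c ^ n\<close>, so its sum is below \<open>2 ^ ((c + 2) * n)\<close>. With
    \<open>n > c + 2\<close> this is less than the number of subsets.\<close>
  define n where "n = c + 3"
  define W where "W = w g ` ({..<n} \<times> {..<n})"
  have fW: "finite W" by (simp add: W_def)
  have cW: "card W = n * n"
    unfolding W_def by (subst card_image) (auto intro: inj_on_subset[OF inj])
  have wle: "w g s \<le> c ^ n" if sn: "s \<in> {..<n} \<times> {..<n}" for s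
  proof -
    obtain i j where s: "s = (i, j)" "i < n" "j < n" using sn by auto
    have "w g s = (p ^ g) ^ i * (q ^ g) ^ j" by (simp add: w_def s power_mult)
    also have "\<dots> \<le> (p ^ g) ^ n * (q ^ g) ^ n"
      using s pos by (intro mult_le_mono power_increasing) auto
    finally show ?thesis by (simp add: c_def power_mult_distrib)
  qed
  have "\<Sum>W \<le> of_nat (card W) * c ^ n"
    using wle by (intro sum_bounded_above) (auto simp: W_def)
  also have "\<dots> < 2 ^ n * 2 ^ n * (2 ^ c) ^ n"
    using less_exp[of n] less_exp[of c] 
    by (simp add: cW) (intro mult_less_le_imp_less mult_strict_mono power_mono, auto simp: c_def pos n_def)
  also have "\<dots> = 2 ^ ((c + 2) * n)"
    by (simp add: power_add power_mult algebra_simps flip: power_mult power2_eq_square)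
  finally have "\<Sum>W + 1 \<le> 2 ^ ((c + 2) * n)" by simp
  also have "(2 :: nat) ^ ((c + 2) * n) < 2 ^ card W"
    by (intro power_strict_increasing) (auto simp: cW n_def algebra_simps)
  finally obtain C D m where CD: "C \<subseteq> W" "D \<subseteq> W" "C \<inter> D = {}" "\<Sum>C = \<Sum>D" "m \<in> C"
      "\<And>x. x \<in> C \<union> D \<Longrightarrow> x \<le> m"
    using exists_disjoint_equal_sums[OF fW] by metis
  define h where "h x = real x / real m" for x :: nat
  have fin: "finite C" "finite D" using CD fW by (auto intro: finite_subset)
  have Wpos: "x > 0" if "x \<in> W" for x using that wpos by (auto simp: W_def)
  have mpos: "m > 0" using CD Wpos by auto
  have injh: "inj h" using mpos by (auto simp: h_def inj_def)
  have Wsm: "x \<in> smooth" if "x \<in> W" for x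
    using that p q by (auto simp: W_def w_def intro!: smooth_mult smooth_power)
  have mW: "m \<in> W" using CD by auto
  have good: "h x \<in> ratios - \<nat> - Y" if x: "x \<in> (C - {m}) \<union> D" for x
  proof -
    have xW: "x \<in> W" and "x \<noteq> m" using x CD by auto
    have "h x \<in> ratios" using Wsm[OF xW] Wsm[OF mW] by (auto simp: ratios_def h_def)
    moreover have "h x \<notin> \<nat>"
    proof
      have "x < m" using CD(6)[of x] x \<open>x \<noteq> m\<close> by auto
      then have "0 < h x" "h x < 1" using Wpos[OF xW] by (auto simp: h_def)
      moreover assume "h x \<in> \<nat>"
      ultimately show False by (auto elim!: Nats_cases)
    qed
    moreover have "h x \<notin> Y"
    proof
      assume "h x \<in> Y"
      obtain s where s: "x = w g s" using xW unfolding W_def by blast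
      obtain t where t: "m = w g t" using mW unfolding W_def by blast
      have "real (w g s) / real (w g t) = h x" unfolding h_def s t ..
      then have "s = t" using g \<open>h x \<in> Y\<close> by blast
      then show False using \<open>x \<noteq> m\<close> s t by simp
    qed
    ultimately show ?thesis by blast
  qed
  have sumh: "\<Sum>(h ` X) = real (\<Sum>X) / real m" for X
    using injh by (subst sum.reindex) (auto simp: h_def sum_divide_distrib intro: inj_on_subset)
  have "real (\<Sum>C) = real m + real (\<Sum>(C - {m}))"
    using sum.remove[OF fin(1) CD(5), of "\<lambda>x. x"] by (simp only: of_nat_add)
  then have "\<Sum>(h ` D) = 1 + \<Sum>(h ` (C - {m}))"
    using CD(4) mpos unfolding sumh by (simp add: field_simps)
  moreover have "h ` (C - {m}) \<inter> h ` D = {}"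
    using CD(3) injD[OF injh] by blast
  moreover have "h ` (C - {m}) \<union> h ` D \<subseteq> ratios - \<nat> - Y" using good by blast
  ultimately show ?thesis using fin by (intro exI[of _ "h ` (C - {m})"] exI[of _ "h ` D"]) simp
qed

text \<open>Addition destroys smoothness of the numerator but keeps a smooth denominator, which is
  all that the later correction modulo 1 needs.\<close>

lemma sum_ratios:
  assumes "finite A" "A \<subseteq> ratios"
  shows "\<exists>c b. b \<in> smooth \<and> \<Sum>A = real c / real b"
  using assms
proof (induction A)
  case empty
  show ?case using smooth_one by (intro exI[of _ 0] exI[of _ 1]) simp
next
  case (insert x A)
  then obtain c b where cb: "b \<in> smooth" "\<Sum>A = real c / real b" by auto
  obtain c' b' where cb': "b' \<in> smooth" "x = real c' / real b'"
    using insert.prems by (auto simp: ratios_def)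
  have "b > 0" "b' > 0" using cb cb' smooth_pos by auto
  moreover have "\<Sum>(insert x A) = x + \<Sum>A" using insert by simp
  ultimately have "\<Sum>(insert x A) = real (c' * b + c * b') / real (b' * b)"
    unfolding cb(2) cb'(2) by (simp add: field_simps)
  then show ?case using cb cb' smooth_mult by blast
qed

text \<open>Induction on \<open>J\<close> with a fresh pair \<open>A\<close>, \<open>B\<close>:
  adding \<open>A\<close> to every old subset shifts the window by \<open>\<Sum>A\<close>, and
  adding \<open>B\<close> instead to the top one reaches one step further. The offset
  \<open>c / b\<close> may be fractional.\<close>

lemma exists_consecutive_subset_sums:
  assumes "p \<in> P" "q \<in> P" "p \<noteq> q"
  shows "\<exists>F c b. finite F \<and> F \<subseteq> ratios - \<nat> \<and> b \<in> smooth \<and>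
    (\<forall>r\<le>J. \<exists>X\<subseteq>F. \<Sum>X = real c / real b + real r)"
proof (induction J)
  case 0
  show ?case using smooth_one by (intro exI[of _ "{}"] exI[of _ 0] exI[of _ 1]) simp
next
  case (Suc J)
  then obtain F c b where F: "finite F" "F \<subseteq> ratios - \<nat>" and b: "b \<in> smooth"
    and sums: "\<And>r. r \<le> J \<Longrightarrow> \<exists>X\<subseteq>F. \<Sum>X = real c / real b + real r" by blast
  obtain A B where AB: "finite A" "finite B" "A \<inter> B = {}" "A \<union> B \<subseteq> ratios - \<nat> - F" "\<Sum>B = 1 + \<Sum>A"
    using exists_unit_difference[OF assms F(1)] by blast
  obtain c' b' where cb': "b' \<in> smooth" "\<Sum>A = real c' / real b'"
    using sum_ratios[OF AB(1)] AB(4) by blast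
  have "b > 0" "b' > 0" using b cb' smooth_pos by auto
  then have M: "real (c * b' + c' * b) / real (b * b') = real c / real b + \<Sum>A"
    using cb' by (simp add: field_simps)
  have sums': "\<exists>X\<subseteq>F \<union> A \<union> B. \<Sum>X = real (c * b' + c' * b) / real (b * b') + real r" if "r \<le> Suc J" for r
  proof (cases "r \<le> J")
    case True
    then obtain X where X: "X \<subseteq> F" "\<Sum>X = real c / real b + real r" using sums by blast
    then have "\<Sum>(X \<union> A) = \<Sum>X + \<Sum>A"
      using F AB by (intro sum.union_disjoint) (auto intro: finite_subset)
    then show ?thesis unfolding M using X by (intro exI[of _ "X \<union> A"]) auto
  next
    case False
    then have r: "r = Suc J" using that by simp
    obtain X where X: "X \<subseteq> F" "\<Sum>X = real c / real b + real J" using sums by blast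
    then have "\<Sum>(X \<union> B) = \<Sum>X + \<Sum>B"
      using F AB by (intro sum.union_disjoint) (auto intro: finite_subset)
    then show ?thesis unfolding M using X AB(5) r by (intro exI[of _ "X \<union> B"]) auto
  qed
  show ?case
  proof (intro exI conjI)
    show "finite (F \<union> A \<union> B)" "F \<union> A \<union> B \<subseteq> ratios - \<nat>" using F AB by auto
    show "b * b' \<in> smooth" using b cb'(1) by (rule smooth_mult)
    show "\<forall>r\<le>Suc J. \<exists>X\<subseteq>F \<union> A \<union> B. \<Sum>X = real (c * b' + c' * b) / real (b * b') + real r"
      using sums' by blast
  qed
qed

text \<open>
  Numbers whose class modulo 1 is a sum of distinct non-integral ratios, avoiding any given finite
  set. Since \<open>q ^ (\<phi>(p ^ n) * l) / p ^ n\<close> is congruent to \<open>1 / p ^ n\<close>, all fractions with smooth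
  denominator have this property.
\<close>

definition fixable :: "real \<Rightarrow> bool" where
  "fixable z \<longleftrightarrow> (\<forall>Y. finite Y \<longrightarrow> (\<exists>V. finite V \<and> V \<subseteq> ratios - \<nat> - Y \<and> \<Sum>V - z \<in> \<int>))"

text \<open>The freedom to avoid \<open>Y\<close> is used here: the second set is chosen to avoid
  the first, so their sums add.\<close>

lemma fixable_add:
  assumes "fixable x" "fixable y"
  shows "fixable (x + y)"
  unfolding fixable_def
proof (intro allI impI)
  fix Y :: "real set" assume Y: "finite Y"
  obtain V where V: "finite V" "V \<subseteq> ratios - \<nat> - Y" "\<Sum>V - x \<in> \<int>"
    using assms(1) Y unfolding fixable_def by blast
  obtain W where W: "finite W" "W \<subseteq> ratios - \<nat> - (Y \<union> V)" "\<Sum>W - y \<in> \<int>"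
    using assms(2) Y V(1) unfolding fixable_def by (meson finite_UnI)
  have "\<Sum>(V \<union> W) = \<Sum>V + \<Sum>W" using V W by (intro sum.union_disjoint) auto
  then have "\<Sum>(V \<union> W) - (x + y) = (\<Sum>V - x) + (\<Sum>W - y)" by simp
  then have "\<Sum>(V \<union> W) - (x + y) \<in> \<int>" using V W Ints_add by metis
  then show "\<exists>V. finite V \<and> V \<subseteq> ratios - \<nat> - Y \<and> \<Sum>V - (x + y) \<in> \<int>"
    using V W by (intro exI[of _ "V \<union> W"]) auto
qed

lemma fixable_of_int: "fixable (of_int m)"
  unfolding fixable_def by (intro allI impI exI[of _ "{}"]) auto

lemma fixable_of_int_divide:
  assumes "fixable (1 / real x)" "x > 0"
  shows "fixable (of_int m / real x)"
proof -
  have nat: "fixable (real n / real x)" for n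
  proof (induction n)
    case 0 show ?case using fixable_of_int[of 0] by simp
  next
    case (Suc n)
    then show ?case using fixable_add[OF assms(1) Suc] by (simp add: add_divide_distrib)
  qed
  \<comment> \<open>Repeated addition of \<open>1 / x\<close> gives only nonnegative numerators, so
    \<open>m\<close> is first reduced modulo \<open>x\<close>.\<close>
  have "of_int m / real x = real (nat (m mod int x)) / real x + of_int (m div int x)"
  proof -
    have "real_of_int m = of_int (m div int x) * real x + of_int (m mod int x)"
      by (metis div_mult_mod_eq of_int_add of_int_mult of_int_of_nat_eq)
    then show ?thesis using assms(2) by (simp add: field_simps)
  qed
  then show ?thesis using fixable_add[OF nat fixable_of_int] by metis
qed

lemma fixable_inverse_prime_power:
  assumes p: "p \<in> P" and q: "q \<in> P" "p \<noteq> q"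
  shows "fixable (1 / real (p ^ n))"
proof (cases "n = 0")
  case True then show ?thesis using fixable_of_int[of 1] by simp
next
  case n: False
  have pq: "prime p" "prime q" using p q prime_P by auto
  then have pos: "p > 0" and q1: "q > 1" using prime_gt_0_nat prime_gt_1_nat by auto
  define e where "e = totient (p ^ n)"
  have e: "e > 0" using pos by (simp add: e_def)
  define v where "v l = real (q ^ (e * l)) / real (p ^ n)" for l
  \<comment> \<open>Infinitely many candidates ensure that one lies outside any finite
    \<open>Y\<close>.\<close>
  have "inj v"
    using pos q1 e by (auto simp: v_def inj_def simp flip: of_nat_power)
  then have inf: "infinite (range v)" by (rule range_inj_infinite)
  have v: "v l \<in> ratios - \<nat> \<and> v l - 1 / real (p ^ n) \<in> \<int>" for l
  proof (intro conjI DiffI)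
    show "v l \<in> ratios" using smooth_power[OF p] smooth_power[OF q(1)] unfolding ratios_def v_def by blast
    show "v l \<notin> \<nat>"
    proof
      assume "v l \<in> \<nat>"
      then obtain m where "v l = real m" by (auto elim: Nats_cases)
      then have "real (q ^ (e * l)) = real (m * p ^ n)" using pos by (simp add: v_def field_simps)
      then have "q ^ (e * l) = m * p ^ n" by (simp only: of_nat_eq_iff)
      moreover have "p dvd m * p ^ n" using n by (simp add: dvd_mult dvd_power)
      ultimately have "p dvd q ^ (e * l)" by simp
      then have "p dvd q" using pq prime_dvd_power by blast
      then show False using pq q(2) primes_dvd_imp_eq by blast
    qed
    have "coprime q (p ^ n)" using pq q(2) by (simp add: primes_coprime)
    then have "[q ^ e = 1] (mod p ^ n)" unfolding e_def by (rule euler_theorem)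
    then have "[(q ^ e) ^ l = 1 ^ l] (mod p ^ n)" by (rule cong_pow)
    then have "p ^ n dvd q ^ (e * l) - 1"
      using cong_to_1_nat[of "q ^ (e * l)" "p ^ n"] by (simp add: power_mult)
    then obtain m where "q ^ (e * l) - 1 = p ^ n * m" by (elim dvdE)
    moreover have "q ^ (e * l) \<ge> 1" using q1 by simp
    ultimately have "q ^ (e * l) = 1 + p ^ n * m" by linarith
    then have "v l - 1 / real (p ^ n) = real m"
      using pos by (simp add: v_def field_simps)
    then show "v l - 1 / real (p ^ n) \<in> \<int>" by simp
  qed
  show ?thesis
    unfolding fixable_def
  proof (intro allI impI)
    fix Y :: "real set" assume "finite Y"
    then have "\<not> range v \<subseteq> Y" using inf finite_subset by blast
    then obtain l where "v l \<notin> Y" by auto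
    then show "\<exists>V. finite V \<and> V \<subseteq> ratios - \<nat> - Y \<and> \<Sum>V - 1 / real (p ^ n) \<in> \<int>"
      using v[of l] by (intro exI[of _ "{v l}"]) auto
  qed
qed

text \<open>Partial fractions: Bezout coefficients split the inverse of a product of coprime
  numbers, which reduces \<open>1 / R ^ n\<close> to inverses of prime powers.\<close>

lemma fixable_of_int_divide_smooth:
  assumes two: "p \<in> P" "q \<in> P" "p \<noteq> q" and b: "b \<in> smooth"
  shows "fixable (of_int m / real b)"
proof -
  have "Q \<subseteq> P \<Longrightarrow> fixable (1 / real (\<Prod>Q ^ n))" if "finite Q" for Q n
    using that
  proof (induction Q)
    case empty show ?case using fixable_of_int[of 1] by simp
  next
    case (insert r Q)
    have pr: "prime r" "\<And>q. q \<in> Q \<Longrightarrow> prime q" using insert prime_P by auto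
    define x where "x = r ^ n"
    define y where "y = \<Prod>Q ^ n"
    have "coprime r (\<Prod>Q)"
      using pr insert by (intro prod_coprime_right) (auto intro: primes_coprime)
    then have "coprime x y" by (simp add: x_def y_def)
    then have "coprime (int x) (int y)" by simp
    then obtain u w where "u * int x + w * int y = 1"
      using bezout_int[of "int x" "int y"] by auto
    then have uw: "of_int u * real x + of_int w * real y = 1"
      by (metis of_int_1 of_int_add of_int_mult of_int_of_nat_eq)
    have pos: "x > 0" "y > 0"
      using pr by (auto simp: x_def y_def intro!: prod_pos dest: prime_gt_0_nat)
    \<comment> \<open>The prime power case for \<open>r\<close> needs powers of a second prime as
      numerators.\<close>
    obtain s where "s \<in> P" "r \<noteq> s" using two by metis
    then have "fixable (1 / real x)"
      unfolding x_def using fixable_inverse_prime_power insert.prems by blast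
    moreover have "fixable (1 / real y)" unfolding y_def using insert by blast
    ultimately have "fixable (of_int w / real x + of_int u / real y)"
      using pos by (intro fixable_add fixable_of_int_divide)
    moreover have "of_int w / real x + of_int u / real y = 1 / (real x * real y)"
      using pos uw by (simp add: field_simps)
    ultimately show ?case using insert by (simp add: x_def y_def power_mult_distrib)
  qed
  from this[OF finite_P] have R: "fixable (of_int k / real (R ^ n))" for k n
    using R_pos by (intro fixable_of_int_divide) (auto simp: R_def)
  obtain n where "b dvd R ^ n" using b by (auto simp: smooth_def)
  then obtain k where k: "R ^ n = b * k" by (elim dvdE)
  then have "b > 0" "k > 0" using R_pos by (metis mult_0 mult_0_right neq0_conv power_not_zero)+
  then have "of_int m / real b = of_int (m * int k) / real (R ^ n)"
    unfolding k by (simp add: field_simps)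
  then show ?thesis using R by metis
qed

text \<open>A set \<open>V\<close> disjoint from \<open>F\<close> with sum congruent to
  \<open>- c / b\<close> modulo 1 makes the offset integral, and nonnegativity makes it a natural
  number.\<close>

lemma exists_consecutive_integer_subset_sums:
  assumes two: "p \<in> P" "q \<in> P" "p \<noteq> q"
  shows "\<exists>F M. finite F \<and> F \<subseteq> ratios - \<nat> \<and> (\<forall>r\<le>J. \<exists>X\<subseteq>F. \<Sum>X = real (M + r))"
proof -
  obtain F c b where F: "finite F" "F \<subseteq> ratios - \<nat>" and b: "b \<in> smooth"
    and sums: "\<And>r. r \<le> J \<Longrightarrow> \<exists>X\<subseteq>F. \<Sum>X = real c / real b + real r"
    using exists_consecutive_subset_sums[OF two, of J] by blast
  have "fixable (of_int (- int c) / real b)"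
    using two b by (rule fixable_of_int_divide_smooth)
  then obtain V where V: "finite V" "V \<subseteq> ratios - \<nat> - F" "\<Sum>V - of_int (- int c) / real b \<in> \<int>"
    using F(1) unfolding fixable_def by blast
  have "\<Sum>V \<ge> 0" using V by (intro sum_nonneg) (auto simp: ratios_def)
  then have "\<Sum>V + real c / real b \<ge> 0" by simp
  moreover have "\<Sum>V + real c / real b \<in> \<int>" using V(3) by simp
  ultimately obtain M where M: "\<Sum>V + real c / real b = real M"
    by (metis Ints_cases of_int_0_le_iff of_int_of_nat_eq zero_le_imp_eq_int)
  have "\<exists>X\<subseteq>F \<union> V. \<Sum>X = real (M + r)" if r: "r \<le> J" for r
  proof -
    obtain X where X: "X \<subseteq> F" "\<Sum>X = real c / real b + real r" using sums[OF r] by blast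
    then have "\<Sum>(X \<union> V) = \<Sum>X + \<Sum>V"
      using F V by (intro sum.union_disjoint) (auto intro: finite_subset)
    then show ?thesis using X M by (intro exI[of _ "X \<union> V"]) auto
  qed
  then show ?thesis using F V by (intro exI[of _ "F \<union> V"] exI[of _ M]) auto
qed

section \<open>Unit fractions\<close>

lemma exists_unit_fraction_sum:
  assumes two: "p \<in> P" "q \<in> P" "p \<noteq> q"
    and gt: "(\<Prod>p\<in>P. real p / (real p - 1)) > 2"
  shows "\<exists>X. finite X \<and> X \<subseteq> smooth - {1} \<and> (\<Sum>x\<in>X. 1 / real x) = 1"
proof -
  have "\<forall>\<^sub>F n in sequentially. (\<Sum>x | x dvd R ^ n. 1 / real x) > 2"
    using sum_inverse_divisors_R_tendsto gt by (rule order_tendstoD)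
  then have "\<forall>\<^sub>F n in sequentially. (\<Sum>x | x dvd R ^ n. 1 / real x) > 2 \<and> n \<ge> Max P"
    using eventually_ge_at_top by (rule eventually_conj)
  then obtain A where A: "(\<Sum>x | x dvd R ^ A. 1 / real x) > 2" "Max P \<le> A"
    using eventually_happens'[OF sequentially_bot] by blast
  have maxP: "r \<le> A" if "r \<in> P" for r
    using that A(2) Max_ge[OF finite_P] le_trans by blast
  define J where "J = R ^ A"
  obtain F M where F: "finite F" "F \<subseteq> ratios - \<nat>"
    and sums: "\<And>r. r \<le> J \<Longrightarrow> \<exists>X\<subseteq>F. \<Sum>X = real (M + r)"
    using exists_consecutive_integer_subset_sums[OF two, of J] by blast
  have "\<forall>f\<in>F. \<exists>a b. a \<in> smooth \<and> b \<in> smooth \<and> f = real a / real b"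
    using F(2) unfolding ratios_def by blast
  then obtain a b where ab: "\<And>f. f \<in> F \<Longrightarrow> a f \<in> smooth \<and> b f \<in> smooth \<and> f = real (a f) / real (b f)"
    by metis
  have "finite (a ` F)" "a ` F \<subseteq> smooth" using F ab by auto
  from finite_smooth_dvd[OF this] obtain m where m: "\<And>n f. n \<ge> m \<Longrightarrow> f \<in> F \<Longrightarrow> a f dvd R ^ n"
    by blast
  \<comment> \<open>\<open>m\<close> makes all numerators \<open>a f\<close> divide
    \<open>N\<close>, \<open>A + R ^ A\<close> is the threshold for the divisor bound, and
    \<open>M\<close> ensures \<open>M \<le> N\<close>.\<close>
  define n where "n = m + A + R ^ A + M"
  define N where "N = R ^ n"
  have Npos: "N > 0" using R_pos by (simp add: N_def)
  have "p dvd R" using dvd_prodI[OF finite_P two(1), of "\<lambda>x. x"] by (simp add: R_def)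
  then have "p \<le> R" using R_pos by (rule dvd_imp_le)
  then have "R \<ge> 2" using prime_ge_2_nat[OF prime_P[OF two(1)]] by simp
  then have "2 ^ n \<le> N" by (simp add: N_def power_mono)
  moreover have "M \<le> n" by (simp add: n_def)
  ultimately have "M \<le> N" using less_exp[of n] by linarith
  define B where "B = {d. d dvd N \<and> d < N}"
  have fB: "finite B" by (simp add: B_def)
  have growth: "d \<le> J + (\<Sum>d' | d' dvd N \<and> d' < d. d')" if "d dvd N" for d
    using divisor_le_sum_smaller_divisors[of A n d] A(1) maxP that
    by (simp add: J_def N_def n_def)
  have small: "d \<le> Suc (J + (\<Sum>d' | d' \<in> B \<and> d' < d. d'))" if "d \<in> B" for d
  proof -
    have "{d'. d' \<in> B \<and> d' < d} = {d'. d' dvd N \<and> d' < d}" using that by (auto simp: B_def)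
    then show ?thesis using growth[of d] that by (simp add: B_def)
  qed
  \<comment> \<open>The divisor bound for \<open>d = N\<close> itself, where the smaller divisors
    are exactly \<open>B\<close>.\<close>
  have "N - M \<le> J + \<Sum>B" using growth[of N] by (simp add: B_def)
  from fB small this have "\<exists>X\<subseteq>B. \<exists>j\<le>J. N - M = j + \<Sum>X"
    by (rule subset_sums_extend)
  then obtain X j where X: "X \<subseteq> B" "j \<le> J" "N - M = j + \<Sum>X" by blast
  \<comment> \<open>The quotients supply both the reserved \<open>M\<close> and the missing
    \<open>j\<close>, so that the total is exactly \<open>N\<close>.\<close>
  obtain Y where Y: "Y \<subseteq> F" "\<Sum>Y = real (M + j)" using sums[OF X(2)] by blast
  define Z where "Z = Y \<union> real ` X"
  have finX: "finite X" and finY: "finite Y" using X Y F fB by (auto intro: finite_subset)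
  have "\<Sum>Z = \<Sum>Y + \<Sum>(real ` X)"
    \<comment> \<open>Disjoint because \<open>Y\<close> contains no natural number.\<close>
    unfolding Z_def using finX finY Y F(2) by (intro sum.union_disjoint) auto
  also have "\<Sum>(real ` X) = real (\<Sum>X)" by (subst sum.reindex) auto
  also have "\<Sum>Y + real (\<Sum>X) = real (M + j + \<Sum>X)" using Y(2) by (simp only: of_nat_add)
  also have "M + j + \<Sum>X = N" using X(3) \<open>M \<le> N\<close> by linarith
  finally have sumZ: "\<Sum>Z = real N" .
  have finZ: "finite Z" using finX finY by (simp add: Z_def)
  have Nsm: "N \<in> smooth" unfolding smooth_def N_def using dvd_refl by blast
  have Zpos: "z > 0" if z: "z \<in> Z" for z
  proof (cases "z \<in> Y")
    case True
    then have "z \<in> ratios" using Y(1) F(2) by blast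
    then show ?thesis by (auto simp: ratios_def dest!: smooth_pos)
  next
    case False
    then obtain d where "z = real d" "d dvd N" using z X(1) by (auto simp: Z_def B_def)
    then show ?thesis using dvd_pos_nat[OF Npos, of d] by simp
  qed
  \<comment> \<open>For a quotient \<open>z = a / b\<close> with \<open>a\<close> dividing
    \<open>N\<close>, the denominator sought is \<open>(N / a) * b\<close>. It is not 1, since
    \<open>z\<close> is never \<open>N\<close>: quotients are not integral and elements of
    \<open>B\<close> are smaller.\<close>
  have Zx: "\<exists>x. x \<in> smooth \<and> x \<noteq> 1 \<and> real x = real N / z" if z: "z \<in> Z" for z
  proof -
    have "z \<noteq> real N"
    proof (cases "z \<in> Y")
      case True then show ?thesis using Y(1) F(2) by auto
    next
      case False then show ?thesis using z X(1) by (auto simp: Z_def B_def)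
    qed
    moreover have "\<exists>x. x \<in> smooth \<and> real x = real N / z"
    proof (cases "z \<in> Y")
      case True
      then have zF: "z \<in> F" using Y by blast
      have "a z dvd N" using m[OF _ zF] by (simp add: N_def n_def)
      then obtain k where k: "N = a z * k" by (elim dvdE)
      then have "k \<in> smooth" using Nsm smooth_dvd by (metis dvd_triv_right)
      then have "k * b z \<in> smooth" using ab[OF zF] smooth_mult by blast
      moreover have "real N / (real (a z) / real (b z)) = real (k * b z)"
        using smooth_pos[of "a z"] smooth_pos[of "b z"] ab[THEN conjunct1, OF zF]
          ab[THEN conjunct2, THEN conjunct1, OF zF] by (simp add: k)
      then have "real (k * b z) = real N / z" using ab[OF zF] by metis
      ultimately show ?thesis by blast
    next
      case False
      then obtain d where d: "z = real d" "d dvd N" using z X(1) by (auto simp: Z_def B_def)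
      then obtain k where k: "N = d * k" by (elim dvdE)
      then have "k \<in> smooth" "d > 0" using Nsm smooth_dvd[of k N] Npos by simp_all
      then show ?thesis using k d by (intro exI[of _ k]) auto
    qed
    ultimately show ?thesis using Zpos[OF z] Npos by auto
  qed
  then obtain h where h: "\<And>z. z \<in> Z \<Longrightarrow> h z \<in> smooth \<and> h z \<noteq> 1 \<and> real (h z) = real N / z"
    by metis
  have inj: "inj_on h Z"
  proof (rule inj_onI)
    fix y z assume yz: "y \<in> Z" "z \<in> Z" "h y = h z"
    then have "real N / y = real N / z" using h by metis
    then show "y = z" using Npos Zpos yz by (simp add: field_simps)
  qed
  have "(\<Sum>x\<in>h ` Z. 1 / real x) = (\<Sum>z\<in>Z. z / real N)"
    using h by (subst sum.reindex[OF inj]) (auto intro!: sum.cong)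
  also have "\<dots> = 1" using sumZ Npos by (simp flip: sum_divide_distrib)
  finally show ?thesis using h finZ by (intro exI[of _ "h ` Z"]) auto
qed

lemma unit_fraction_sum_imp_prod_gt:
  assumes X: "finite X" "X \<subseteq> smooth - {1}" "(\<Sum>x\<in>X. 1 / real x) = 1"
  shows "(\<Prod>p\<in>P. real p / (real p - 1)) > 2"
proof -
  have "P \<noteq> {}"
  proof
    assume "P = {}"
    then have "R = 1" unfolding R_def by simp
    then have "smooth = {1}" unfolding smooth_def by simp
    then have "X = {}" using X(2) by blast
    then show False using X(3) by simp
  qed
  obtain n where n: "\<And>x. x \<in> X \<Longrightarrow> x dvd R ^ n" using finite_smooth_dvd[of X] X by blast
  have "2 = (\<Sum>x\<in>insert 1 X. 1 / real x)" using X by (subst sum.insert) auto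
  also have "\<dots> \<le> (\<Sum>x | x dvd R ^ n. 1 / real x)"
    using n finite_divisors_R by (intro sum_mono2) auto
  also have "\<dots> < (\<Prod>p\<in>P. real p / (real p - 1))"
    using \<open>P \<noteq> {}\<close> by (rule sum_inverse_divisors_R_less)
  finally show ?thesis .
qed

end

section \<open>From sets of primes to the list formulation\<close>

text \<open>A single factor \<open>p / (p - 1)\<close> is at most 2. This supplies the two primes
  that the construction works with.\<close>

lemma two_distinct_elements_if_prod_gt:
  assumes "finite P" "\<And>p. p \<in> P \<Longrightarrow> prime p" "(\<Prod>p\<in>P. real p / (real p - 1)) > 2"
  shows "\<exists>p\<in>P. \<exists>q\<in>P. p \<noteq> q"
proof (rule ccontr)
  assume "\<not> ?thesis"
  then consider "P = {}" | p where "P = {p}" by blast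
  then show False
  proof cases
    case 1 then show ?thesis using assms(3) by simp
  next
    case (2 p)
    have "real p \<ge> 2" using assms(2)[of p] 2 prime_ge_2_nat by simp
    then have "real p / (real p - 1) \<le> 2" by (simp add: field_simps)
    then show ?thesis using assms(3) 2 by simp
  qed
qed

text \<open>Distinctness lets exponents indexed by list positions be indexed by primes; those of a
  smooth number are its multiplicities.\<close>

lemma S_eq_smooth:
  assumes "distinct ps" "\<forall>p\<in>set ps. prime p"
  shows "S ps = finite_prime_set.smooth (set ps)"
proof -
  interpret finite_prime_set "set ps" using assms(2) by unfold_locales auto
  have S: "S ps = {\<Prod>p\<in>set ps. p ^ \<beta> p | \<beta>. True}"
  proof (intro equalityI subsetI)
    fix x assume "x \<in> S ps"
    then obtain \<alpha> where x: "x = (\<Prod>i<length ps. (ps ! i) ^ \<alpha> i)" by (auto simp: S_def)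
    have bij: "bij_betw (\<lambda>i. ps ! i) {..<length ps} (set ps)"
      using assms(1) by (rule bij_betw_nth) auto
    define \<beta> where "\<beta> p = \<alpha> (the_inv_into {..<length ps} (\<lambda>i. ps ! i) p)" for p
    have "x = (\<Prod>i<length ps. (ps ! i) ^ \<beta> (ps ! i))"
      unfolding x \<beta>_def using bij_betw_imp_inj_on[OF bij]
      by (intro prod.cong) (simp_all add: the_inv_into_f_f)
    also have "\<dots> = (\<Prod>p\<in>set ps. p ^ \<beta> p)" by (rule prod.reindex_bij_betw[OF bij])
    finally show "x \<in> {\<Prod>p\<in>set ps. p ^ \<beta> p | \<beta>. True}" by blast
  next
    fix x assume "x \<in> {\<Prod>p\<in>set ps. p ^ \<beta> p | \<beta>. True}"
    then obtain \<beta> where x: "x = (\<Prod>p\<in>set ps. p ^ \<beta> p)" by blast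
    have bij: "bij_betw (\<lambda>i. ps ! i) {..<length ps} (set ps)"
      using assms(1) by (rule bij_betw_nth) auto
    have "x = (\<Prod>i<length ps. (ps ! i) ^ \<beta> (ps ! i))"
      unfolding x by (rule prod.reindex_bij_betw[OF bij, symmetric])
    then show "x \<in> S ps" unfolding S_def by (intro CollectI exI[of _ "\<lambda>i. \<beta> (ps ! i)"]) simp
  qed
  show ?thesis
  proof (intro equalityI subsetI)
    fix x assume "x \<in> S ps"
    then obtain \<beta> where x: "x = (\<Prod>p\<in>set ps. p ^ \<beta> p)" using S by blast
    have "(\<Prod>p\<in>Q. p ^ \<beta> p) \<in> smooth" if "finite Q" "Q \<subseteq> set ps" for Q
      using that by (induction Q) (auto intro: smooth_mult smooth_power smooth_one[simplified])
    then show "x \<in> smooth" using x by simp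
  next
    fix x assume x: "x \<in> smooth"
    then have pos: "x > 0" by (rule smooth_pos)
    have "x = (\<Prod>p\<in>set ps. p ^ multiplicity p x)"
    proof (rule multiplicity_eq_nat[OF pos])
      show "(\<Prod>p\<in>set ps. p ^ multiplicity p x) > 0"
        using prime_P by (intro prod_pos) (auto dest: prime_gt_0_nat)
      fix r :: nat assume r: "prime r"
      have "multiplicity r x = 0" if "r \<notin> set ps"
      proof -
        obtain n where "x dvd R ^ n" using x by (auto simp: smooth_def)
        then have "multiplicity r x \<le> multiplicity r (R ^ n)"
          using R_pos by (intro dvd_imp_multiplicity_le) auto
        then show ?thesis using multiplicity_R_notin[OF r that] by simp
      qed
      then show "multiplicity r x = multiplicity r (\<Prod>p\<in>set ps. p ^ multiplicity p x)"
        using multiplicity_prod_prime_powers[OF finite_P prime_P r, of "\<lambda>p. multiplicity p x"]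
        by auto
    qed
    then show "x \<in> S ps"
      unfolding S by (intro CollectI exI[of _ "\<lambda>p. multiplicity p x"] conjI TrueI)
  qed
qed

theorem theorem3:
  fixes ps :: "nat list"
  assumes "distinct ps" and "\<forall>p\<in>set ps. prime p"
  shows "K ps \<noteq> {} \<longleftrightarrow> (\<Prod>i<length ps. real (ps ! i) / (real (ps ! i) - 1)) > 2"
proof -
  interpret finite_prime_set "set ps" using assms(2) by unfold_locales auto
  have S: "S ps = smooth" using S_eq_smooth[OF assms] .
  have bij: "bij_betw (\<lambda>i. ps ! i) {..<length ps} (set ps)"
    using assms(1) by (rule bij_betw_nth) auto
  have prod: "(\<Prod>i<length ps. real (ps ! i) / (real (ps ! i) - 1)) = (\<Prod>p\<in>set ps. real p / (real p - 1))"
    by (rule prod.reindex_bij_betw[OF bij])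
  \<comment> \<open>Finiteness matters here, as \<open>card\<close> is 0 on infinite sets.\<close>
  have K: "K ps \<noteq> {} \<longleftrightarrow> (\<exists>k\<ge>1. solutions k ps \<noteq> {})"
    using finite_solutions by (auto simp: K_def T_def Suc_le_eq card_gt_0_iff)
  show ?thesis
    unfolding K prod
  proof
    assume "\<exists>k\<ge>1. solutions k ps \<noteq> {}"
    then obtain xs where xs: "sorted_wrt (<) xs" "\<forall>x\<in>set xs. 1 < x \<and> x \<in> smooth"
        "(\<Sum>x\<leftarrow>xs. 1 / real x) = 1"
      by (auto simp: solutions_def S)
    have "distinct xs" using xs(1) by (simp add: strict_sorted_iff)
    then have "(\<Sum>x\<in>set xs. 1 / real x) = 1" using xs(3) by (simp add: sum_list_distinct_conv_sum_set)
    then show "(\<Prod>p\<in>set ps. real p / (real p - 1)) > 2"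
      using xs(2) by (intro unit_fraction_sum_imp_prod_gt[of "set xs"]) auto
  next
    assume gt: "(\<Prod>p\<in>set ps. real p / (real p - 1)) > 2"
    then obtain p q where two: "p \<in> set ps" "q \<in> set ps" "p \<noteq> q"
      using two_distinct_elements_if_prod_gt[OF finite_P prime_P] by blast
    obtain X where X: "finite X" "X \<subseteq> smooth - {1}" "(\<Sum>x\<in>X. 1 / real x) = 1"
      using exists_unit_fraction_sum[OF two gt] by blast
    define xs where "xs = sorted_list_of_set X"
    have "X \<noteq> {}" using X(3) by auto
    then have "length xs \<ge> 1" using X(1) by (simp add: xs_def Suc_le_eq card_gt_0_iff)
    moreover have "1 < x" if "x \<in> X" for x
    proof -
      have "x \<in> smooth" "x \<noteq> 1" using that X(2) by auto
      then show ?thesis using smooth_pos[of x] by simp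
    qed
    then have "xs \<in> solutions (length xs) ps"
      using X unfolding solutions_def xs_def S
      by (auto simp: sum_list_distinct_conv_sum_set)
    ultimately show "\<exists>k\<ge>1. solutions k ps \<noteq> {}" by blast
  qed
qed

end
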